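(* Let $\lambda\in\mathbb{C}_p$ with $\lambda\ne0$ and $|\lambda|_p\le1$ ($p$ an odd prime), and let $r\in\mathbb{N}$. For every $n\ge0$, \[ \mathcal{E}^{(r)}_{n,\lambda}(x)=\sum_{m=0}^nCh^{(r)}_{m,\lambda}(x)\,S_2(n,m). \]
   Context: $S_2(n,m)$ are the Stirling numbers of the second kind: $x^n=\sum_{m=0}^nS_2(n,m)\,x(x-1)\cdots(x-m+1)$. Write $(x)_{0,\lambda}=1$, $(x)_{n,\lambda}=x(x-\lambda)\cdots(x-(n-1)\lambda)$, and $(1+\lambda u)^{x/\lambda}=\sum_{m\ge0}(x)_{m,\lambda}u^m/m!$. Higher-order degenerate Changhee polynomials of the second kind: $\left(\frac{2}{1+(1+\lambda\log(1+t))^{1/\lambda}}\right)^r(1+\lambda\log(1+t))^{x/\lambda}=\sum_{n\ge0}Ch^{(r)}_{n,\lambda}(x)\frac{t^n}{n!}$. Carlitz's degenerate Euler polynomials of order $r$: $\left(\frac{2}{(1+\lambda t)^{1/\lambda}+1}\right)^r(1+\lambda t)^{x/\lambda}=\sum_{n\ge0}\mathcal{E}^{(r)}_{n,\lambda}(x)\frac{t^n}{n!}$. *)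

theory Defs
  imports
    "HOL-Computational_Algebra.Computational_Algebra"
    "HOL-Combinatorics.Stirling"
begin

definition algebraic_over :: "'a::field set \<Rightarrow> 'a set" where
  "algebraic_over S = {x. \<exists>f. f \<noteq> 0 \<and> (\<forall>i. coeff f i \<in> S) \<and> poly f x = 0}"

(* In a complete extension of the rationals whose absolute value restricts to the p-adic one,
   the topological closure of the prime field is a copy of the p-adic numbers. *)
definition padic_numbers :: "('a::field_char_0 \<Rightarrow> real) \<Rightarrow> 'a set" where
  "padic_numbers v = {x. \<exists>q. (\<lambda>n. v (of_rat (q n) - x)) \<longlonglongrightarrow> 0}"

(* The field 'a with absolute value v is the completion of an algebraic closure of the p-adic
   numbers, i.e. a copy of C_p. This determines ('a, v) up to isometric isomorphism. The
   algebraic closure occurs as the set of elements that are algebraic over the p-adic numbers: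
   it is required to be algebraically closed and to be dense in the complete field 'a. *)
locale padic_complex_field =
  fixes p :: nat and v :: "'a::field_char_0 \<Rightarrow> real"
  assumes prime_p: "prime p"
    and nonneg: "0 \<le> v x"
    and zero_iff: "v x = 0 \<longleftrightarrow> x = 0"
    and mult: "v (x * y) = v x * v y"
    and ultrametric: "v (x + y) \<le> max (v x) (v y)"
    and normalized: "v (of_nat p) = 1 / real p"
    and complete:
      "(\<And>e. 0 < e \<Longrightarrow> \<exists>N. \<forall>i\<ge>N. \<forall>j\<ge>N. v (s i - s j) < e) \<Longrightarrow>
         \<exists>l. (\<lambda>i. v (s i - l)) \<longlonglongrightarrow> 0"
    and algebraic_elements_closed:
      "(\<And>i. coeff f i \<in> algebraic_over (padic_numbers v)) \<Longrightarrow> degree f > 0 \<Longrightarrow>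
         \<exists>x \<in> algebraic_over (padic_numbers v). poly f x = 0"
    and algebraic_elements_dense:
      "\<exists>s. (\<forall>i. s i \<in> algebraic_over (padic_numbers v)) \<and> (\<lambda>i. v (s i - x)) \<longlonglongrightarrow> 0"

definition degen_ffact :: "'a::comm_ring_1 \<Rightarrow> 'a \<Rightarrow> nat \<Rightarrow> 'a" where
  "degen_ffact lam x n = (\<Prod>i<n. x - of_nat i * lam)"

(* The formal power series (1 + lam u)^(x / lam) in u. *)
definition degen_exp :: "'a::field_char_0 \<Rightarrow> 'a \<Rightarrow> 'a fps" where
  "degen_exp lam x = Abs_fps (\<lambda>m. degen_ffact lam x m / fact m)"

lemma degen_exp_eq_binomial:
  fixes lam x :: "'a::field_char_0"
  assumes "lam \<noteq> 0"
  shows "degen_exp lam x = fps_binomial (x / lam) oo (fps_const lam * fps_X)"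
proof (rule fps_ext)
  fix n
  have "(\<Prod>i<n. x - of_nat i * lam) = (\<Prod>i<n. lam * (x / lam - of_nat i))"
    using assms by (intro prod.cong) (simp_all add: field_simps)
  also have "\<dots> = lam ^ n * (\<Prod>i<n. x / lam - of_nat i)"
    by (simp add: prod.distrib)
  finally show "fps_nth (degen_exp lam x) n
      = fps_nth (fps_binomial (x / lam) oo (fps_const lam * fps_X)) n"
    by (simp add: degen_exp_def degen_ffact_def gbinomial_prod_rev atLeast0LessThan
        fps_compose_linear)
qed

(* fps_ln 1 is the formal series log (1 + t), so composition with it substitutes
   u = log (1 + t). *)
definition degen_Changhee :: "nat \<Rightarrow> nat \<Rightarrow> 'a::field_char_0 \<Rightarrow> 'a \<Rightarrow> 'a" where
  "degen_Changhee r n lam x =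
     fact n * fps_nth ((2 / (1 + (degen_exp lam 1 oo fps_ln 1))) ^ r * (degen_exp lam x oo fps_ln 1)) n"

definition degen_Euler :: "nat \<Rightarrow> nat \<Rightarrow> 'a::field_char_0 \<Rightarrow> 'a \<Rightarrow> 'a" where
  "degen_Euler r n lam x =
     fact n * fps_nth ((2 / (degen_exp lam 1 + 1)) ^ r * degen_exp lam x) n"

(* The library defines the Stirling numbers of the second kind by recursion; this is their
   defining property as connection coefficients. *)
lemma power_eq_sum_Stirling:
  fixes x :: "'a::comm_ring_1"
  shows "x ^ n = (\<Sum>m\<le>n. of_nat (Stirling n m) * degen_ffact 1 x m)"
proof (induction n)
  case 0
  show ?case by (simp add: degen_ffact_def)
next
  case (Suc n)
  let ?S = "\<lambda>n m. of_nat (Stirling n m) :: 'a" and ?f = "degen_ffact 1 x"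
  have step: "x * ?f m = ?f (Suc m) + of_nat m * ?f m" for m
    by (simp add: degen_ffact_def algebra_simps)
  have shift: "(\<Sum>m\<le>n. ?S n m * (of_nat m * ?f m))
      = (\<Sum>m\<le>n. ?S n (Suc m) * (of_nat (Suc m) * ?f (Suc m)))"
  proof -
    have "(\<Sum>m\<le>n. ?S n m * (of_nat m * ?f m)) = (\<Sum>m\<le>Suc n. ?S n m * (of_nat m * ?f m))"
      by simp
    also have "\<dots> = (\<Sum>m\<le>n. ?S n (Suc m) * (of_nat (Suc m) * ?f (Suc m)))"
      by (simp only: sum.atMost_Suc_shift) simp
    finally show ?thesis .
  qed
  have "x ^ Suc n = (\<Sum>m\<le>n. ?S n m * (x * ?f m))"
    by (simp add: Suc.IH sum_distrib_left mult.left_commute)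
  also have "\<dots> = (\<Sum>m\<le>n. ?S n m * ?f (Suc m)) + (\<Sum>m\<le>n. ?S n m * (of_nat m * ?f m))"
    by (simp only: step distrib_left sum.distrib)
  also have "\<dots> = (\<Sum>m\<le>n. ?S (Suc n) (Suc m) * ?f (Suc m))"
    unfolding shift sum.distrib[symmetric] by (intro sum.cong refl) (simp add: algebra_simps)
  also have "\<dots> = (\<Sum>m\<le>Suc n. ?S (Suc n) m * ?f m)"
    by (simp only: sum.atMost_Suc_shift) simp
  finally show ?case .
qed

end

theory Submission
  imports Defs
begin

text \<open>Let G(t) be the exponential generating function of the degenerate Euler polynomials.
  That of the Changhee polynomials is G(log(1+t)), so substituting e^t - 1 for t recovers G. Since
  (e^t - 1)^m / m! generates the Stirling numbers \<open>Stirling n m\<close>, comparing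
  coefficients gives the identity. \<open>fps_nth_eq_sum_Stirling\<close> does this for arbitrary G;
  \<open>degen_Changhee_eq_compose_ln\<close> supplies the substitution.\<close>

lemma fps_nth_exp_minus_one_power:
  "fps_nth ((fps_exp (1 :: 'a::field_char_0) - 1) ^ m) n = fact m * of_nat (Stirling n m) / fact n"
proof (induction n arbitrary: m)
  case 0
  show ?case by (cases m) simp_all
next
  case (Suc n)
  show ?case
  proof (cases m)
    case 0
    then show ?thesis by simp
  next
    case (Suc k)
    let ?A = "\<lambda>j. (fps_exp (1::'a) - 1) ^ j"
    \<comment> \<open>Writing e^t = (e^t - 1) + 1 in the derivative turns it into the Stirling
      recurrence on coefficients.\<close>
    have "fps_deriv (?A (Suc k)) = of_nat (Suc k) * (fps_exp 1 * ?A k)"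
      by (simp add: fps_deriv_power fps_of_nat mult_ac del: power_Suc of_nat_Suc)
    also have "fps_exp 1 * ?A k = ?A (Suc k) + ?A k"
      by (simp add: algebra_simps)
    finally have "fps_deriv (?A (Suc k)) = of_nat (Suc k) * (?A (Suc k) + ?A k)" .
    then have "of_nat (Suc n) * fps_nth (?A (Suc k)) (Suc n)
        = of_nat (Suc k) * (fps_nth (?A (Suc k)) n + fps_nth (?A k) n)"
      by (metis Suc_eq_plus1 fps_add_nth fps_deriv_nth fps_mult_of_nat_nth(1))
    also have "\<dots> = of_nat (Suc n) * (fact m * of_nat (Stirling (Suc n) m) / fact (Suc n))"
      unfolding Suc.IH \<open>m = Suc k\<close> by (simp add: divide_simps del: of_nat_Suc) (simp add: algebra_simps)
    finally show ?thesis
      unfolding \<open>m = Suc k\<close> using mult_left_cancel of_nat_neq_0 by blast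
  qed
qed

text \<open>Holds because log(1+t) and e^t - 1 are compositional inverses: expand G as a series in
  powers of e^t - 1.\<close>

lemma fps_nth_eq_sum_Stirling:
  fixes G :: "'a::field_char_0 fps"
  shows "fact n * fps_nth G n
    = (\<Sum>m=0..n. fact m * fps_nth (G oo fps_ln 1) m * of_nat (Stirling n m))"
proof -
  have "fps_ln 1 oo (fps_exp (1::'a) - 1) = fps_X"
    by (simp add: fps_ln_fps_exp_inv fps_inv)
  then have "G = (G oo fps_ln 1) oo (fps_exp 1 - 1)"
    by (simp add: fps_compose_assoc[symmetric])
  then have "fps_nth G n = fps_nth ((G oo fps_ln 1) oo (fps_exp 1 - 1)) n"
    by simp
  then show ?thesis
    by (simp add: fps_compose_nth fps_nth_exp_minus_one_power sum_distrib_left mult_ac)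
qed

text \<open>Makes the constant term of the denominator \<open>degen_exp lam 1 + 1\<close> equal to
  2, hence nonzero, so that the quotient can be composed termwise.\<close>

lemma degen_exp_nth_0 [simp]: "fps_nth (degen_exp lam x) 0 = 1"
  by (simp add: degen_exp_def degen_ffact_def)

text \<open>Since log(1+t) has no constant term, substituting it respects sums, products, powers and
  division by units.\<close>

lemma degen_Changhee_eq_compose_ln:
  "degen_Changhee r n lam x
     = fact n * fps_nth (((2 / (degen_exp lam 1 + 1)) ^ r * degen_exp lam x) oo fps_ln 1) n"
proof -
  have "(2 / (degen_exp lam 1 + 1)) oo fps_ln 1 = 2 / (1 + (degen_exp lam 1 oo fps_ln 1))"
    by (simp add: fps_divide_compose fps_compose_add_distrib numeral_fps_const add.commute)
  then show ?thesis
    by (simp add: degen_Changhee_def fps_compose_mult_distrib fps_compose_power[symmetric])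
qed

theorem theorem2p10:
  fixes p r n :: nat and v :: "'a::field_char_0 \<Rightarrow> real" and lam x :: 'a
  assumes "prime p" and "odd p"
    and "padic_complex_field p v"
    and "lam \<noteq> 0" and "v lam \<le> 1"
  shows "degen_Euler r n lam x = (\<Sum>m=0..n. degen_Changhee r m lam x * of_nat (Stirling n m))"
  unfolding degen_Euler_def degen_Changhee_eq_compose_ln by (rule fps_nth_eq_sum_Stirling)

end
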